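(* Let $1<p,q<\infty$ and let $G$ be a $\sigma$-finite LCA group with Haar measure $\lambda_G$. Let $\mu$ be a finite Borel measure on $G$ and $\nu$ a Borel measure on $\widehat{G}$. Suppose that $\mu=\phi\,d\lambda_G$ is absolutely continuous with respect to $\lambda_G$. If $\nu$ is a $(p,q)$-frame measure for $\mu$ with frame bounds $A,B>0$, then $$\frac{B}{A}\ge\left(\frac{\operatorname{ess\,sup}_\mu(\phi)}{\operatorname{ess\,inf}_\mu(\phi)}\right)^{q(1-\frac1p)}.$$ In particular, if $\operatorname{ess\,sup}_\mu(\phi)=\infty$ or $\operatorname{ess\,inf}_\mu(\phi)=0$, then there is no $(p,q)$-frame measure for $\mu$.
   Context: $G$ is a locally compact Hausdorff abelian (LCA) group, written additively, which is metrizable and a countable union of compact sets; $\sigma$-finite means that its Haar measure is $\sigma$-finite. $\widehat{G}$ is its dual group (continuous characters), and $\langle x,\gamma\rangle$ denotes the value of $\gamma\in\widehat{G}$ at $x\in G$. Measures are non-negative. For a non-negative Borel function $f$ on $G$: $\operatorname{ess\,sup}_\mu(f)=\inf\{M\in[0,\infty]: f\le M\ \mu\text{-a.e.}\}$ and $\operatorname{ess\,inf}_\mu(f)=\sup\{m\in[0,\infty): f\ge m\ \mu\text{-a.e.}\}$. For a finite Borel measure $\mu$ on $G$ and $f\in L^1(\mu)$, $\widehat{fd\mu}(\gamma)=\int_G f(x)\overline{\langle x,\gamma\rangle}\,d\mu(x)$ for $\gamma\in\widehat{G}$. A Borel measure $\nu$ on $\widehat{G}$ is a $(p,q)$-frame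 measure for $\mu$ with frame bounds $A,B$ if $0<A\le B<\infty$ and $A\|f\|_{L^p(\mu)}^q\le\|\widehat{fd\mu}\|_{L^q(\nu)}^q\le B\|f\|_{L^p(\mu)}^q$ for all $f\in L^p(\mu)$. *)

theory Defs
  imports "HOL-Analysis.Analysis" "HOL-Probability.Essential_Supremum"
begin

definition sigma_compact_space :: "'a topology \<Rightarrow> bool" where
  "sigma_compact_space T \<longleftrightarrow>
     (\<exists>K :: nat \<Rightarrow> 'a set. (\<forall>n. compactin T (K n)) \<and> topspace T = (\<Union>n. K n))"

text \<open>Haar measures are nonzero translation-invariant Radon measures.\<close>

definition haar_measure :: "'a::{topological_ab_group_add, t2_space} measure \<Rightarrow> bool" where
  "haar_measure h \<longleftrightarrow>
     sets h = sets borel \<and>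
     emeasure h UNIV \<noteq> 0 \<and>
     (\<forall>a. \<forall>E\<in>sets borel. emeasure h ((+) a ` E) = emeasure h E) \<and>
     (\<forall>K. compact K \<longrightarrow> emeasure h K < \<infinity>) \<and>
     (\<forall>E\<in>sets borel. emeasure h E = (INF U\<in>{U. open U \<and> E \<subseteq> U}. emeasure h U)) \<and>
     (\<forall>U. open U \<longrightarrow> emeasure h U = (SUP K\<in>{K. compact K \<and> K \<subseteq> U}. emeasure h K))"

typedef (overloaded) 'a dual_group =
  "{\<gamma> :: 'a::topological_ab_group_add \<Rightarrow> complex. continuous_on UNIV \<gamma> \<and>
     (\<forall>x. norm (\<gamma> x) = 1) \<and> (\<forall>x y. \<gamma> (x + y) = \<gamma> x * \<gamma> y)}"
  morphisms char_apply Abs_dual_group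
  by (rule exI[of _ "\<lambda>_. 1"]) simp

text \<open>The group law is pointwise multiplication, written additively; inverses are complex conjugates.\<close>

instantiation dual_group :: (topological_ab_group_add) ab_group_add
begin

definition zero_dual_group :: "'a dual_group" where
  "zero_dual_group = Abs_dual_group (\<lambda>_. 1)"

definition plus_dual_group :: "'a dual_group \<Rightarrow> 'a dual_group \<Rightarrow> 'a dual_group" where
  "plus_dual_group \<gamma> \<delta> = Abs_dual_group (\<lambda>x. char_apply \<gamma> x * char_apply \<delta> x)"

definition uminus_dual_group :: "'a dual_group \<Rightarrow> 'a dual_group" where
  "uminus_dual_group \<gamma> = Abs_dual_group (\<lambda>x. cnj (char_apply \<gamma> x))"

definition minus_dual_group :: "'a dual_group \<Rightarrow> 'a dual_group \<Rightarrow> 'a dual_group" where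
  "minus_dual_group \<gamma> \<delta> = \<gamma> + - \<delta>"

lemma char_apply_zero: "char_apply (0 :: 'a dual_group) = (\<lambda>_. 1)"
  unfolding zero_dual_group_def by (rule Abs_dual_group_inverse) simp

lemma char_apply_plus:
  fixes \<gamma> \<delta> :: "'a dual_group"
  shows "char_apply (\<gamma> + \<delta>) = (\<lambda>x. char_apply \<gamma> x * char_apply \<delta> x)"
  unfolding plus_dual_group_def
  using char_apply[of \<gamma>] char_apply[of \<delta>]
  by (intro Abs_dual_group_inverse) (auto intro!: continuous_on_mult simp: norm_mult)

lemma char_apply_uminus:
  fixes \<gamma> :: "'a dual_group"
  shows "char_apply (- \<gamma>) = (\<lambda>x. cnj (char_apply \<gamma> x))"
  unfolding uminus_dual_group_def
  using char_apply[of \<gamma>]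
  by (intro Abs_dual_group_inverse) (auto intro!: continuous_on_cnj)

instance
proof
  fix a b c :: "'a dual_group"
  show "a + b + c = a + (b + c)" "a + b = b + a" "0 + a = a"
    by (simp_all add: char_apply_inject[symmetric] char_apply_plus char_apply_zero mult_ac)
  have "cnj (char_apply a x) * char_apply a x = 1" for x
    using char_apply[of a] complex_norm_square[of "char_apply a x"] by (simp add: mult.commute)
  then show "- a + a = 0"
    by (simp add: char_apply_inject[symmetric] char_apply_plus char_apply_uminus char_apply_zero)
  show "a - b = a + - b"
    by (rule minus_dual_group_def)
qed

end

text \<open>The dual group carries the compact-open topology.\<close>

instantiation dual_group :: (topological_ab_group_add) topological_space
begin

definition open_dual_group :: "'a dual_group set \<Rightarrow> bool" where
  "open_dual_group = generate_topology
     {V. \<exists>K U. compact K \<and> open U \<and> V = {\<gamma>. char_apply \<gamma> ` K \<subseteq> U}}"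

instance
  by intro_classes (auto simp: open_dual_group_def
      intro: generate_topology.UNIV generate_topology.Int generate_topology.UN)

end

text \<open>Only used for exponents \<^term>\<open>r > 0\<close>, so that the value at \<^term>\<open>\<infinity>\<close> is \<^term>\<open>\<infinity>\<close>.\<close>

definition ennreal_powr :: "ennreal \<Rightarrow> real \<Rightarrow> ennreal" where
  "ennreal_powr x r = (if x = \<infinity> then \<infinity> else ennreal (enn2real x powr r))"

definition Lp_norm :: "real \<Rightarrow> 'b measure \<Rightarrow> ('b \<Rightarrow> complex) \<Rightarrow> ennreal" where
  "Lp_norm p M f = ennreal_powr (\<integral>\<^sup>+ x. ennreal (norm (f x) powr p) \<partial>M) (1 / p)"

definition Lp_space :: "real \<Rightarrow> 'b measure \<Rightarrow> ('b \<Rightarrow> complex) set" where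
  "Lp_space p M = {f \<in> borel_measurable M. Lp_norm p M f < \<infinity>}"

text \<open>\<open>fourier_transform \<mu> f\<close> is the Fourier transform of the complex measure \<open>f d\<mu>\<close>.\<close>

definition fourier_transform ::
    "'a::topological_ab_group_add measure \<Rightarrow> ('a \<Rightarrow> complex) \<Rightarrow> 'a dual_group \<Rightarrow> complex" where
  "fourier_transform \<mu> f \<gamma> = (\<integral>x. f x * cnj (char_apply \<gamma> x) \<partial>\<mu>)"

definition frame_measure ::
    "real \<Rightarrow> real \<Rightarrow> 'a::topological_ab_group_add measure \<Rightarrow> 'a dual_group measure
      \<Rightarrow> real \<Rightarrow> real \<Rightarrow> bool" where
  "frame_measure p q \<mu> \<nu> A B \<longleftrightarrow>
     sets \<nu> = sets borel \<and> 0 < A \<and> A \<le> B \<and>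
     (\<forall>f\<in>Lp_space p \<mu>.
        ennreal A * ennreal_powr (Lp_norm p \<mu> f) q
          \<le> ennreal_powr (Lp_norm q \<nu> (fourier_transform \<mu> f)) q \<and>
        ennreal_powr (Lp_norm q \<nu> (fourier_transform \<mu> f)) q
          \<le> ennreal B * ennreal_powr (Lp_norm p \<mu> f) q)"

text \<open>The essential supremum is \<^const>\<open>esssup\<close> at type \<^typ>\<open>ennreal\<close>; see \<open>esssup_eq_AE\<close>.\<close>

definition essinf :: "'a measure \<Rightarrow> ('a \<Rightarrow> ennreal) \<Rightarrow> ennreal" where
  "essinf \<mu> f = Sup {m. m < \<infinity> \<and> (AE x in \<mu>. m \<le> f x)}"

end

theory Submission
  imports Defs
begin

text \<open>
  Translating a function by \<open>a\<close> only multiplies its Fourier transform by the unimodular factor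
  \<open>\<gamma>(-a)\<close>. By Fubini, any two Borel sets of positive Haar measure overlap with positive measure
  after a suitable translation. So if \<open>\<phi> < s\<close> and \<open>\<phi> > t\<close> each hold on a set of positive measure,
  there are translates \<open>E\<^sub>1\<close>, \<open>E\<^sub>2\<close> of each other inside these two sets. The functions
  \<open>1\<^bsub>E\<^sub>1\<^esub> / \<phi>\<close> and \<open>1\<^bsub>E\<^sub>2\<^esub> / \<phi>\<close> have Fourier transforms of equal modulus, while the ratio
  of their \<open>L\<^sup>p(\<mu>)\<close> norms is at least \<open>(t/s)\<^bsup>1-1/p\<^esup>\<close>.
  The frame inequalities compare the two, and then \<open>t\<close> and \<open>s\<close> tend to the essential bounds.
\<close>

section \<open>Second countability from metrizability and sigma-compactness\<close>

lemma Lindelof_space_sigma_compact: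
  assumes "sigma_compact_space X"
  shows "Lindelof_space X"
proof -
  obtain K :: "nat \<Rightarrow> 'a set" where K: "\<And>n. compactin X (K n)" and U: "topspace X = (\<Union>n. K n)"
    using assms unfolding sigma_compact_space_def by blast
  have "Lindelof_space (subtopology X (\<Union>(range K)))"
    by (rule Lindelof_space_Union)
       (use K in \<open>auto simp: compactin_subspace intro: compact_imp_Lindelof_space\<close>)
  then show ?thesis
    by (simp add: U[symmetric])
qed

text \<open>For each \<open>n\<close> the Lindelof property extracts a countable cover by balls of
  radius 1/(n+1). The union over \<open>n\<close> is a base: a covering ball through
  \<open>x\<close> of radius below r/2 lies in the ball of radius \<open>r\<close> about
  \<open>x\<close>.\<close>

lemma second_countable_metrizable_Lindelof:
  assumes "metrizable_space X" and L: "Lindelof_space X"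
  shows "second_countable X"
proof -
  obtain M d where "Metric_space M d" and X: "X = Metric_space.mtopology M d"
    using assms(1) unfolding metrizable_space_def by blast
  interpret Metric_space M d by fact
  have "\<exists>V. countable V \<and> V \<subseteq> (\<lambda>x. mball x (1 / Suc n)) ` M \<and> \<Union>V = M" for n
    using Lindelof_spaceD[OF L, of "(\<lambda>x. mball x (1 / Suc n)) ` M"]
    by (force simp: X)
  then obtain V where V: "\<And>n. countable (V n)" "\<And>n. V n \<subseteq> (\<lambda>x. mball x (1 / Suc n)) ` M"
      "\<And>n. \<Union>(V n) = M"
    by metis
  show ?thesis
    unfolding second_countable_def
  proof (intro exI[of _ "\<Union>n. V n"] conjI ballI allI impI)
    show "countable (\<Union>n. V n)" using V(1) by simp
    show "openin X W" if "W \<in> (\<Union>n. V n)" for W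
      using that V(2) by (fastforce simp: X)
    fix U x assume Ux: "openin X U \<and> x \<in> U"
    then obtain r where r: "r > 0" "mball x r \<subseteq> U" and xM: "x \<in> M"
      unfolding X openin_mtopology by blast
    obtain n where n: "1 / Suc n < r / 2"
      using r(1) by (meson half_gt_zero nat_approx_posE)
    obtain W y where W: "W \<in> V n" "x \<in> W" "W = mball y (1 / Suc n)" "y \<in> M"
      using V(2,3)[of n] xM by blast
    have "z \<in> mball x r" if "z \<in> W" for z
    proof -
      have "d x z \<le> d y x + d y z" using that xM W by (intro triangle'') auto
      then show ?thesis using that xM W n by auto
    qed
    then show "\<exists>W\<in>(\<Union>n. V n). x \<in> W \<and> W \<subseteq> U"
      using W r by blast
  qed
qed

text \<open>In general the Borel sets of a product can exceed the product sigma-algebra. A countable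
  base writes the open preimage as a countable union of open rectangles, which makes Fubini
  available for sets defined through x - y.\<close>

lemma borel_measurable_diff_second_countable:
  assumes "second_countable (euclidean :: 'a::topological_group_add topology)"
  shows "(\<lambda>(x, y). x - y :: 'a) \<in> borel \<Otimes>\<^sub>M borel \<rightarrow>\<^sub>M borel"
proof (rule borel_measurableI)
  fix S :: "'a set" assume S: "open S"
  obtain B :: "'a set set" where cB: "countable B" and oB: "\<And>V. V \<in> B \<Longrightarrow> open V"
    and B: "\<And>U x. open U \<Longrightarrow> x \<in> U \<Longrightarrow> \<exists>V\<in>B. x \<in> V \<and> V \<subseteq> U"
    using assms unfolding second_countable_def by (auto simp: open_openin[symmetric])
  define W where "W = (\<lambda>(x, y). x - y) -` S"
  have "continuous_on UNIV (\<lambda>z :: 'a \<times> 'a. fst z - snd z)"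
    by (intro continuous_intros)
  then have oW: "open W"
    using S unfolding W_def by (auto simp: case_prod_beta' dest: open_vimage)
  define I where "I = {(U, V). U \<in> B \<and> V \<in> B \<and> U \<times> V \<subseteq> W}"
  have "W \<subseteq> (\<Union>(U, V)\<in>I. U \<times> V)"
  proof
    fix z assume "z \<in> W"
    then obtain P Q where PQ: "open P" "open Q" "z \<in> P \<times> Q" "P \<times> Q \<subseteq> W"
      using oW open_prod_elim by metis
    obtain U where "U \<in> B" "fst z \<in> U" "U \<subseteq> P" using B[of P "fst z"] PQ by auto
    moreover obtain V where "V \<in> B" "snd z \<in> V" "V \<subseteq> Q" using B[of Q "snd z"] PQ by auto
    ultimately have "(U, V) \<in> I" "z \<in> U \<times> V"
      using PQ(4) by (auto simp: I_def mem_Times_iff)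
    then show "z \<in> (\<Union>(U, V)\<in>I. U \<times> V)" by blast
  qed
  then have W_eq: "W = (\<Union>(U, V)\<in>I. U \<times> V)" by (auto simp: I_def)
  have "countable I"
    by (rule countable_subset[OF _ countable_SIGMA[OF cB, of "\<lambda>_. B"]]) (use cB in \<open>auto simp: I_def\<close>)
  then have "W \<in> sets (borel \<Otimes>\<^sub>M borel)"
    unfolding W_eq by (rule sets.countable_UN') (auto simp: I_def oB)
  then show "(\<lambda>(x, y). x - y) -` S \<inter> space (borel \<Otimes>\<^sub>M borel) \<in> sets (borel \<Otimes>\<^sub>M borel :: ('a \<times> 'a) measure)"
    by (simp add: W_def space_pair_measure)
qed

section \<open>Haar measure: translation and overlaps\<close>

lemma haar_measure_sets: "haar_measure h \<Longrightarrow> sets h = sets borel"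
  by (simp add: haar_measure_def)

lemma haar_measure_translate:
  "haar_measure h \<Longrightarrow> E \<in> sets borel \<Longrightarrow> emeasure h ((+) a ` E) = emeasure h E"
  by (simp add: haar_measure_def)

lemma plus_image_eq_vimage: "(+) a ` E = (+) (- a) -` E" for a :: "'a::ab_group_add"
  by (force simp: image_iff)

lemma borel_measurable_translate: "(+) a \<in> borel \<rightarrow>\<^sub>M borel" for a :: "'a::topological_group_add"
  by (intro borel_measurable_continuous_onI continuous_intros)

lemma distr_haar_translate:
  assumes h: "haar_measure h"
  shows "distr h h ((+) a) = h"
proof (rule measure_eqI)
  note sets_h[measurable_cong] = haar_measure_sets[OF h]
  have m: "(+) a \<in> h \<rightarrow>\<^sub>M h"
    using borel_measurable_translate by (simp cong: measurable_cong_sets add: sets_h)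
  show "emeasure (distr h h ((+) a)) E = emeasure h E" if "E \<in> sets (distr h h ((+) a))" for E
  proof -
    have E: "E \<in> sets borel" using that sets_h by simp
    have "(+) a -` E = (+) (- a) ` E"
      using plus_image_eq_vimage[of "- a" E] by simp
    then show ?thesis
      using E haar_measure_translate[OF h E, of "-a"] m sets_h sets_eq_imp_space_eq[OF sets_h]
      by (simp add: emeasure_distr)
  qed
qed simp

text \<open>Measure \<open>W\<close> in both orders. Its sections at fixed \<open>x\<close> are the
  sets of the conclusion; its section at \<open>y\<close> in \<open>F\<close> is the translate y +
  E. If all the former were null, the product of the measures of \<open>E\<close> and
  \<open>F\<close> would vanish.\<close>

lemma haar_measure_reflected_overlap:
  assumes h: "haar_measure h" and sf: "sigma_finite_measure h"
    and sc: "second_countable (euclidean :: 'a::{topological_ab_group_add, t2_space} topology)"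
    and E: "E \<in> sets borel" "emeasure h E \<noteq> 0" and F: "F \<in> sets borel" "emeasure h F \<noteq> 0"
  shows "\<exists>x :: 'a. emeasure h {y \<in> F. x - y \<in> E} \<noteq> 0"
proof (rule ccontr)
  assume "\<nexists>x. emeasure h {y \<in> F. x - y \<in> E} \<noteq> 0"
  then have z: "emeasure h {y \<in> F. x - y \<in> E} = 0" for x by blast
  note sets_h[measurable_cong] = haar_measure_sets[OF h]
  have sp: "space h = UNIV" using sets_eq_imp_space_eq[OF sets_h] by simp
  interpret sigma_finite_measure h by fact
  interpret P: pair_sigma_finite h h ..
  define W where "W = {(x, y). y \<in> F \<and> x - y \<in> E}"
  have "(\<lambda>(x, y). x - y) \<in> h \<Otimes>\<^sub>M h \<rightarrow>\<^sub>M borel"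
    using borel_measurable_diff_second_countable[OF sc]
    by (simp cong: measurable_cong_sets sets_pair_measure_cong add: sets_h)
  from measurable_sets[OF this E(1)]
  have "(\<lambda>(x, y). x - y) -` E \<inter> (UNIV \<times> F) \<in> sets (h \<Otimes>\<^sub>M h)"
    using F(1) by (auto simp: space_pair_measure sp sets_h)
  also have "(\<lambda>(x, y). x - y) -` E \<inter> (UNIV \<times> F) = W" by (auto simp: W_def)
  finally have W: "W \<in> sets (h \<Otimes>\<^sub>M h)" .
  have "(\<integral>\<^sup>+y. emeasure h ((\<lambda>x. (x, y)) -` W) \<partial>h) = (\<integral>\<^sup>+x. emeasure h (Pair x -` W) \<partial>h)"
    using P.emeasure_pair_measure_alt2[OF W] emeasure_pair_measure_alt[OF W] by simp
  also have "\<dots> = 0"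
    using z by (simp add: W_def)
  finally have 0: "(\<integral>\<^sup>+y. emeasure h ((\<lambda>x. (x, y)) -` W) \<partial>h) = 0" .
  have "(\<lambda>x. (x, y)) -` W = (if y \<in> F then (+) y ` E else {})" for y
    by (auto simp: W_def plus_image_eq_vimage)
  then have "emeasure h ((\<lambda>x. (x, y)) -` W) = emeasure h E * indicator F y" for y
    using haar_measure_translate[OF h E(1)] by (simp add: indicator_def)
  then show False
    using 0 E F by (simp add: nn_integral_cmult sets_h)
qed

text \<open>Putting -E for \<open>E\<close> turns reflection into translation: a - y lies in -E iff
  y lies in a + E. The definition of \<open>haar_measure\<close> speaks of translations, not of
  inversion, so that -E is non-null must be derived first.\<close>

lemma haar_measure_translate_overlap:
  assumes h: "haar_measure h" and sf: "sigma_finite_measure h"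
    and sc: "second_countable (euclidean :: 'a::{topological_ab_group_add, t2_space} topology)"
    and E: "E \<in> sets borel" "emeasure h E \<noteq> 0" and F: "F \<in> sets borel" "emeasure h F \<noteq> 0"
  shows "\<exists>a :: 'a. emeasure h (F \<inter> (+) a ` E) \<noteq> 0"
proof -
  have m: "uminus ` E \<in> sets borel"
  proof -
    have "(uminus :: 'a \<Rightarrow> 'a) \<in> borel \<rightarrow>\<^sub>M borel"
      by (intro borel_measurable_continuous_onI continuous_intros)
    from measurable_sets[OF this E(1)] have "uminus -` E \<in> sets borel" by simp
    also have "uminus -` E = uminus ` E" by (force simp: image_iff)
    finally show ?thesis .
  qed
  \<comment> \<open>Inversion preserves non-null sets: an overlap of \<open>E\<close> with some \<open>x - E\<close> makes \<open>-E\<close> non-null.\<close>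
  obtain x where x: "emeasure h {y \<in> E. x - y \<in> E} \<noteq> 0"
    using haar_measure_reflected_overlap[OF h sf sc E E] by blast
  have "{y \<in> E. x - y \<in> E} \<subseteq> (+) x ` uminus ` E"
    by (auto simp: image_iff) (metis diff_add_cancel uminus_add_conv_diff minus_diff_eq)
  moreover have "(+) x ` uminus ` E \<in> sets borel"
    using measurable_sets[OF borel_measurable_translate[of "-x"] m]
    by (simp add: plus_image_eq_vimage)
  ultimately have "emeasure h ((+) x ` uminus ` E) \<noteq> 0"
    using x emeasure_mono[of _ _ h] haar_measure_sets[OF h] by (metis le_zero_eq)
  then have "emeasure h (uminus ` E) \<noteq> 0"
    using haar_measure_translate[OF h m] by simp
  from haar_measure_reflected_overlap[OF h sf sc m this F]
  obtain a where a: "emeasure h {y \<in> F. a - y \<in> uminus ` E} \<noteq> 0" by blast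
  have "a - y \<in> uminus ` E \<longleftrightarrow> y \<in> (+) a ` E" for y
    by (simp add: plus_image_eq_vimage image_iff) (metis minus_diff_eq minus_minus)
  with a have "emeasure h (F \<inter> (+) a ` E) \<noteq> 0"
    by (simp add: Int_def)
  then show ?thesis ..
qed

section \<open>Fourier transforms and norms of the test functions\<close>

lemma dual_group_char_apply:
  fixes \<gamma> :: "'a::topological_ab_group_add dual_group"
  shows "(\<lambda>x. cnj (char_apply \<gamma> x)) \<in> borel_measurable borel"
    and "norm (char_apply \<gamma> x) = 1"
    and "char_apply \<gamma> (x + y) = char_apply \<gamma> x * char_apply \<gamma> y"
  using char_apply[of \<gamma>] by (auto intro!: borel_measurable_continuous_onI continuous_on_cnj)

lemma fourier_transform_density_indicator:
  assumes h: "haar_measure h" and \<phi>: "\<phi> \<in> borel_measurable borel" "\<And>x. 0 \<le> \<phi> x"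
    and S: "S \<in> sets borel" "\<And>x. x \<in> S \<Longrightarrow> 0 < \<phi> x"
  shows "fourier_transform (density h (\<lambda>x. ennreal (\<phi> x))) (\<lambda>x. indicator S x / complex_of_real (\<phi> x)) \<gamma>
    = (\<integral>x. indicator S x * cnj (char_apply \<gamma> x) \<partial>h)"
proof -
  note sets_h[measurable_cong] = haar_measure_sets[OF h]
  note [measurable] = dual_group_char_apply(1)[of \<gamma>] \<phi>(1) S(1)
  have "fourier_transform (density h (\<lambda>x. ennreal (\<phi> x))) (\<lambda>x. indicator S x / complex_of_real (\<phi> x)) \<gamma>
    = (\<integral>x. \<phi> x *\<^sub>R (indicator S x / complex_of_real (\<phi> x) * cnj (char_apply \<gamma> x)) \<partial>h)"
    unfolding fourier_transform_def using \<phi>(2)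
    by (intro integral_density) simp_all
  also have "\<dots> = (\<integral>x. indicator S x * cnj (char_apply \<gamma> x) \<partial>h)"
    using S(2) by (intro Bochner_Integration.integral_cong)
      (fastforce simp: indicator_def scaleR_conv_of_real)+
  finally show ?thesis .
qed

text \<open>Substituting a + x for x pulls out the conjugate of \<gamma>(a), a constant of modulus
  1.\<close>

lemma norm_fourier_indicator_translate:
  assumes h: "haar_measure h" and S: "S \<in> sets borel"
  shows "norm (\<integral>x. indicator ((+) a ` S) x * cnj (char_apply \<gamma> x) \<partial>h)
       = norm (\<integral>x. indicator S x * cnj (char_apply \<gamma> x) \<partial>h)"
proof -
  note sets_h[measurable_cong] = haar_measure_sets[OF h]
  note [measurable] = dual_group_char_apply(1)[of \<gamma>] S borel_measurable_translate[of a]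
    borel_measurable_translate[of "- a"]
  have [measurable]: "(+) a ` S \<in> sets borel"
    using measurable_sets[OF borel_measurable_translate S, of "- a"]
    by (simp add: plus_image_eq_vimage)
  have "(\<integral>x. indicator ((+) a ` S) x * cnj (char_apply \<gamma> x) \<partial>h)
      = (\<integral>x. indicator ((+) a ` S) x * cnj (char_apply \<gamma> x) \<partial>distr h h ((+) a))"
    by (simp add: distr_haar_translate[OF h])
  also have "\<dots> = (\<integral>x. indicator ((+) a ` S) (a + x) * cnj (char_apply \<gamma> (a + x)) \<partial>h)"
    by (rule integral_distr) measurable
  also have "\<dots> = (\<integral>x. cnj (char_apply \<gamma> a) * (indicator S x * cnj (char_apply \<gamma> x)) \<partial>h)"
    by (intro Bochner_Integration.integral_cong)
       (auto simp: indicator_def dual_group_char_apply(3))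
  also have "\<dots> = cnj (char_apply \<gamma> a) * (\<integral>x. indicator S x * cnj (char_apply \<gamma> x) \<partial>h)"
    by simp
  finally show ?thesis
    by (simp add: norm_mult dual_group_char_apply(2))
qed

text \<open>One factor \<phi> comes from the density and \<phi> to the power -p from the test
  function. The resulting exponent 1 - p is the source of 1 - 1/p in the final bound.\<close>

lemma nn_integral_density_indicator_powr:
  assumes h: "haar_measure h" and \<phi>: "\<phi> \<in> borel_measurable borel" "\<And>x. 0 \<le> \<phi> x"
    and S: "S \<in> sets borel" "\<And>x. x \<in> S \<Longrightarrow> 0 < \<phi> x" and p: "0 < p"
  shows "(\<integral>\<^sup>+x. ennreal (norm (indicator S x / complex_of_real (\<phi> x)) powr p) \<partial>density h (\<lambda>x. ennreal (\<phi> x)))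
    = (\<integral>\<^sup>+x. ennreal (\<phi> x powr (1 - p)) * indicator S x \<partial>h)"
proof -
  note sets_h[measurable_cong] = haar_measure_sets[OF h]
  note [measurable] = \<phi>(1) S(1)
  have "(\<integral>\<^sup>+x. ennreal (norm (indicator S x / complex_of_real (\<phi> x)) powr p) \<partial>density h (\<lambda>x. ennreal (\<phi> x)))
    = (\<integral>\<^sup>+x. ennreal (\<phi> x) * ennreal (norm (indicator S x / complex_of_real (\<phi> x)) powr p) \<partial>h)"
    by (intro nn_integral_density) measurable
  also have "\<dots> = (\<integral>\<^sup>+x. ennreal (\<phi> x powr (1 - p)) * indicator S x \<partial>h)"
  proof (intro nn_integral_cong)
    fix x
    show "ennreal (\<phi> x) * ennreal (norm (indicator S x / complex_of_real (\<phi> x)) powr p)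
        = ennreal (\<phi> x powr (1 - p)) * indicator S x"
    proof (cases "x \<in> S")
      case True
      then have "\<phi> x > 0" using S(2) by simp
      then have "\<phi> x * (1 / \<phi> x) powr p = \<phi> x powr (1 - p)"
        by (simp add: powr_divide powr_diff)
      then show ?thesis
        using True \<open>\<phi> x > 0\<close> by (simp add: norm_divide ennreal_mult'[symmetric])
    qed simp
  qed
  finally show ?thesis .
qed

text \<open>Once the integral is a finite real, the frame inequalities can be compared in the
  reals.\<close>

lemma Lp_norm_powr:
  assumes "(\<integral>\<^sup>+x. ennreal (norm (f x) powr p) \<partial>M) = ennreal I" "0 \<le> I"
  shows "Lp_norm p M f < \<infinity>" "ennreal_powr (Lp_norm p M f) q = ennreal (I powr (q / p))"
  using assms by (simp_all add: Lp_norm_def ennreal_powr_def powr_powr)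

section \<open>The frame inequalities at two levels, and the limit to the essential bounds\<close>

lemma frame_measure_level_ratio:
  fixes h \<mu> :: "'a::{topological_ab_group_add, t2_space} measure" and \<phi> :: "'a \<Rightarrow> real"
  assumes h: "haar_measure h" and sf: "sigma_finite_measure h"
    and sc: "second_countable (euclidean :: 'a topology)"
    and p: "1 < p" and q: "1 < q"
    and \<phi>: "\<phi> \<in> borel_measurable borel" "\<And>x. 0 \<le> \<phi> x"
    and \<mu>: "\<mu> = density h (\<lambda>x. ennreal (\<phi> x))" and fin: "finite_measure \<mu>"
    and frame: "frame_measure p q \<mu> \<nu> A B"
    and s: "0 < s" "emeasure h {x. 0 < \<phi> x \<and> \<phi> x < s} \<noteq> 0"
    and t: "0 < t" "emeasure h {x. t < \<phi> x} \<noteq> 0"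
  shows "(t / s) powr (q * (1 - 1 / p)) \<le> B / A"
proof -
  note sets_h[measurable_cong] = haar_measure_sets[OF h]
  note [measurable] = \<phi>(1)
  have AB: "0 < A" "A \<le> B" using frame by (auto simp: frame_measure_def)
  \<comment> \<open>A positive lower bound for \<^term>\<open>\<phi>\<close> keeps \<open>1 / \<phi>\<close> in \<open>L\<^sup>p\<close> on the set.\<close>
  have "\<exists>n. emeasure h {x. 1 / Suc n < \<phi> x \<and> \<phi> x < s} \<noteq> 0"
  proof (rule ccontr)
    assume "\<nexists>n. emeasure h {x. 1 / Suc n < \<phi> x \<and> \<phi> x < s} \<noteq> 0"
    then have "(\<Union>n. {x. 1 / Suc n < \<phi> x \<and> \<phi> x < s}) \<in> null_sets h"
      by (intro null_sets_UN') (auto simp: null_sets_def)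
    moreover have "{x. 0 < \<phi> x \<and> \<phi> x < s} \<subseteq> (\<Union>n. {x. 1 / Suc n < \<phi> x \<and> \<phi> x < s})"
    proof clarify
      fix x assume "0 < \<phi> x" "\<phi> x < s"
      moreover obtain n where "1 / Suc n < \<phi> x" using \<open>0 < \<phi> x\<close> nat_approx_posE by metis
      ultimately show "x \<in> (\<Union>n. {x. 1 / Suc n < \<phi> x \<and> \<phi> x < s})" by blast
    qed
    ultimately show False
      using s(2) null_sets_subset[of _ h "{x. 0 < \<phi> x \<and> \<phi> x < s}"] by auto
  qed
  then obtain r where r: "0 < r" and E0: "emeasure h {x. r < \<phi> x \<and> \<phi> x < s} \<noteq> 0"
    by (metis of_nat_0_less_iff zero_less_Suc zero_less_divide_1_iff)
  define E where "E = {x. r < \<phi> x \<and> \<phi> x < s}"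
  define F where "F = {x. t < \<phi> x}"
  have EF[measurable]: "E \<in> sets borel" "F \<in> sets borel" by (simp_all add: E_def F_def)
  obtain a where a: "emeasure h (F \<inter> (+) a ` E) \<noteq> 0"
    using haar_measure_translate_overlap[OF h sf sc EF(1) _ EF(2)] E0 t(2)
    unfolding E_def F_def by blast
  \<comment> \<open>The same overlap seen from both sides: \<open>E2\<close> inherits \<phi> > t
    from \<open>F\<close>, its translate back \<open>E1\<close> inherits r < \<phi> < s from
    \<open>E\<close>.\<close>
  define E2 where "E2 = F \<inter> (+) a ` E"
  define E1 where "E1 = E \<inter> (+) a -` F"
  have E1[measurable]: "E1 \<in> sets borel"
    using measurable_sets[OF borel_measurable_translate EF(2), of a] by (simp add: E1_def)
  have E2_eq: "E2 = (+) a ` E1" by (auto simp: E1_def E2_def)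
  have E2[measurable]: "E2 \<in> sets borel"
    using measurable_sets[OF borel_measurable_translate E1, of "- a"]
    by (simp add: plus_image_eq_vimage E2_eq)
  have E1_bd: "0 < \<phi> x" "r < \<phi> x" "\<phi> x < s" if "x \<in> E1" for x
    using that r by (auto simp: E1_def E_def)
  have E2_bd: "0 < \<phi> x" "t < \<phi> x" if "x \<in> E2" for x
    using that t(1) by (auto simp: E2_def F_def)
  have h21: "emeasure h E2 = emeasure h E1"
    unfolding E2_eq by (rule haar_measure_translate[OF h E1])
  \<comment> \<open>\<open>h\<close> may be infinite, but \<phi> > t on \<open>E2\<close> bounds t
    times its Haar measure by its finite \<mu>-measure.\<close>
  have "emeasure h E2 < \<infinity>"
  proof -
    have "ennreal t * emeasure h E2 = (\<integral>\<^sup>+x. ennreal t * indicator E2 x \<partial>h)"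
      by (simp add: nn_integral_cmult)
    also have "\<dots> \<le> (\<integral>\<^sup>+x. ennreal (\<phi> x) * indicator E2 x \<partial>h)"
      using E2_bd by (intro nn_integral_mono) (simp add: indicator_def ennreal_leI less_imp_le)
    also have "\<dots> = emeasure \<mu> E2"
      by (simp add: \<mu> emeasure_density)
    also have "\<dots> < \<infinity>"
      using finite_measure.emeasure_finite[OF fin] by (simp add: less_top[symmetric])
    finally show ?thesis
      using t(1) by (auto simp: ennreal_mult_less_top)
  qed
  with a h21 obtain v where v: "0 < v" "emeasure h E1 = ennreal v" "emeasure h E2 = ennreal v"
    unfolding E2_def[symmetric]
    by (cases "emeasure h E2") (fastforce simp: less_le)+
  \<comment> \<open>Dividing by \<^term>\<open>\<phi>\<close> cancels the density, so the transforms below are those of indicators against \<^term>\<open>h\<close>.\<close>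
  define f where "f S x = indicator S x / complex_of_real (\<phi> x)" for S x
  define J where "J S = (\<integral>\<^sup>+x. ennreal (norm (f S x) powr p) \<partial>\<mu>)" for S
  have f_meas: "f S \<in> borel_measurable \<mu>" if [measurable]: "S \<in> sets borel" for S
    unfolding f_def \<mu> by measurable
  \<comment> \<open>Since 1 - p < 0, a lower bound on \<phi> gives an upper bound on
    \<open>J\<close>. It is applied with c = t on \<open>E2\<close>, and with c = r on
    \<open>E1\<close> only for finiteness.\<close>
  have J_le: "J S \<le> ennreal (c powr (1 - p) * v)"
    if "S \<in> sets borel" "\<And>x. x \<in> S \<Longrightarrow> c < \<phi> x" "0 < c" "emeasure h S = ennreal v" for S c
  proof -
    have [measurable]: "S \<in> sets borel" by fact
    have "J S = (\<integral>\<^sup>+x. ennreal (\<phi> x powr (1 - p)) * indicator S x \<partial>h)"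
      unfolding J_def f_def \<mu> using that p \<phi>
      by (intro nn_integral_density_indicator_powr[OF h]) (auto intro: less_trans)
    also have "\<dots> \<le> (\<integral>\<^sup>+x. ennreal (c powr (1 - p)) * indicator S x \<partial>h)"
      using that(2,3) p
      by (intro nn_integral_mono)
         (simp add: indicator_def ennreal_leI powr_mono2' less_imp_le)
    also have "\<dots> = ennreal (c powr (1 - p) * v)"
      using that(4) v(1) by (simp add: nn_integral_cmult ennreal_mult)
    finally show ?thesis .
  qed
  have J_ge: "ennreal (s powr (1 - p) * v) \<le> J E1"
  proof -
    have "ennreal (s powr (1 - p) * v) = (\<integral>\<^sup>+x. ennreal (s powr (1 - p)) * indicator E1 x \<partial>h)"
      using v by (simp add: nn_integral_cmult ennreal_mult)
    also have "\<dots> \<le> (\<integral>\<^sup>+x. ennreal (\<phi> x powr (1 - p)) * indicator E1 x \<partial>h)"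
      using E1_bd p
      by (intro nn_integral_mono)
         (simp add: indicator_def ennreal_leI powr_mono2' less_imp_le)
    also have "\<dots> = J E1"
      unfolding J_def f_def \<mu> using E1_bd p \<phi>
      by (intro nn_integral_density_indicator_powr[OF h, symmetric]) auto
    finally show ?thesis .
  qed
  have "J E1 < top" "J E2 < top"
    using J_le[OF E1 E1_bd(2) r v(2)] J_le[OF E2 E2_bd(2) t(1) v(3)]
    by (auto intro: le_less_trans)
  then obtain I1 I2 where I: "0 \<le> I1" "J E1 = ennreal I1" "0 \<le> I2" "J E2 = ennreal I2"
    by (metis ennreal_cases less_irrefl infinity_ennreal_def)
  have I1: "s powr (1 - p) * v \<le> I1"
    using J_ge I by simp
  have I2: "I2 \<le> t powr (1 - p) * v"
    using J_le[OF E2 E2_bd(2) t(1) v(3)] I v(1) by simp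
  note L1 = Lp_norm_powr[OF I(2)[unfolded J_def] I(1)]
  note L2 = Lp_norm_powr[OF I(4)[unfolded J_def] I(3)]
  have "norm (fourier_transform \<mu> (f E2) \<gamma>) = norm (fourier_transform \<mu> (f E1) \<gamma>)" for \<gamma>
    unfolding f_def \<mu>
    using fourier_transform_density_indicator[OF h \<phi> E1 E1_bd(1), of \<gamma>]
      fourier_transform_density_indicator[OF h \<phi> E2 E2_bd(1), of \<gamma>]
      norm_fourier_indicator_translate[OF h E1, of a \<gamma>]
    by (simp add: E2_eq)
  then have eq: "Lp_norm q \<nu> (fourier_transform \<mu> (f E2)) = Lp_norm q \<nu> (fourier_transform \<mu> (f E1))"
    by (simp add: Lp_norm_def)
  have "f E1 \<in> Lp_space p \<mu>" "f E2 \<in> Lp_space p \<mu>"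
    using f_meas E1 E2 L1(1) L2(1) by (auto simp: Lp_space_def)
  \<comment> \<open>The lower frame inequality for \<open>f E1\<close> and the upper one for
    \<open>f E2\<close> are chained through the common \<open>L\<^sup>q(\<nu>)\<close> norm. The
    common Haar measure \<open>v\<close> cancels later.\<close>
  then have "ennreal A * ennreal_powr (Lp_norm p \<mu> (f E1)) q
      \<le> ennreal B * ennreal_powr (Lp_norm p \<mu> (f E2)) q"
    using frame eq unfolding frame_measure_def by (metis order_trans)
  then have main: "A * I1 powr (q / p) \<le> B * I2 powr (q / p)"
    using AB by (simp add: L1(2) L2(2) ennreal_mult[symmetric])
  have "A * (s powr (1 - p) * v) powr (q / p) \<le> A * I1 powr (q / p)"
    using I1 AB p q v s by (intro mult_left_mono powr_mono2) auto
  also have "\<dots> \<le> B * I2 powr (q / p)" by (rule main)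
  also have "\<dots> \<le> B * (t powr (1 - p) * v) powr (q / p)"
    using I2 I AB p q by (intro mult_left_mono powr_mono2) auto
  finally have "A * (s powr ((1 - p) * (q / p)) * v powr (q / p))
      \<le> B * (t powr ((1 - p) * (q / p)) * v powr (q / p))"
    using v s t by (simp add: powr_mult powr_powr)
  moreover define e where "e = q * (1 - 1 / p)"
  moreover have "(1 - p) * (q / p) = - e"
    using p by (simp add: e_def field_simps)
  ultimately have "A * s powr (- e) \<le> B * t powr (- e)"
    using v(1) by (simp add: mult.assoc[symmetric])
  then show ?thesis
    unfolding e_def[symmetric]
    using AB s(1) t(1) by (simp add: powr_minus powr_divide field_simps)
qed

theorem theorem2p16:
  fixes p q :: real
    and h \<mu> :: "'a::{topological_ab_group_add, t2_space} measure"
    and \<phi> :: "'a \<Rightarrow> real"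
  assumes "locally_compact_space (euclidean :: 'a topology)"
    and "metrizable_space (euclidean :: 'a topology)"
    and "sigma_compact_space (euclidean :: 'a topology)"
    and "haar_measure h" and "sigma_finite_measure h"
    and "1 < p" and "1 < q"
    and "sets \<mu> = sets borel" and "finite_measure \<mu>"
    and "\<phi> \<in> borel_measurable borel" and "\<And>x. 0 \<le> \<phi> x"
    and "\<mu> = density h (\<lambda>x. ennreal (\<phi> x))"
  shows "(\<forall>\<nu> A B. frame_measure p q \<mu> \<nu> A B \<longrightarrow>
            ennreal (B / A) \<ge>
              ennreal_powr (esssup \<mu> (\<lambda>x. ennreal (\<phi> x)) / essinf \<mu> (\<lambda>x. ennreal (\<phi> x)))
                (q * (1 - 1 / p))) \<and>
         (esssup \<mu> (\<lambda>x. ennreal (\<phi> x)) = \<infinity> \<or> essinf \<mu> (\<lambda>x. ennreal (\<phi> x)) = 0 \<longrightarrow>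
            \<not> (\<exists>\<nu> A B. frame_measure p q \<mu> \<nu> A B))"
proof -
  note h = assms(4) and sf = assms(5) and p = assms(6) and q = assms(7)
    and \<phi> = assms(10,11) and \<mu> = assms(12)
  note sets_h[measurable_cong] = haar_measure_sets[OF h]
  note sets_\<mu>[measurable_cong] = assms(8)
  note [measurable] = \<phi>(1)
  have sp: "space \<mu> = UNIV" "space h = UNIV"
    using sets_eq_imp_space_eq[OF sets_h] sets_eq_imp_space_eq[OF sets_\<mu>] by simp_all
  have sc: "second_countable (euclidean :: 'a topology)"
    using assms(2,3) by (intro second_countable_metrizable_Lindelof Lindelof_space_sigma_compact)
  define e where "e = q * (1 - 1 / p)"
  have e: "e > 0" using p q by (simp add: e_def)
  define M where "M = esssup \<mu> (\<lambda>x. ennreal (\<phi> x))"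
  define m where "m = essinf \<mu> (\<lambda>x. ennreal (\<phi> x))"
  \<comment> \<open>The zero set of \<phi> is invisible to \<mu>; hence the condition 0 < \<phi> in
    \<open>lower\<close>.\<close>
  have AE_\<mu>: "(AE x in \<mu>. P x) \<longleftrightarrow> (AE x in h. 0 < \<phi> x \<longrightarrow> P x)" for P
    unfolding \<mu> by (subst AE_density) simp_all
  have meas: "(\<lambda>x. ennreal (\<phi> x)) \<in> \<mu> \<rightarrow>\<^sub>M borel" by measurable
  have upper: "emeasure h {x. t < \<phi> x} \<noteq> 0" if "ennreal t < M" "0 \<le> t" for t
  proof
    assume "emeasure h {x. t < \<phi> x} = 0"
    then have "AE x in h. \<phi> x \<le> t"
      by (subst AE_iff_measurable[OF _ refl]) (simp_all add: sp not_le)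
    then have "AE x in \<mu>. ennreal (\<phi> x) \<le> ennreal t"
      unfolding AE_\<mu> by eventually_elim (simp add: ennreal_leI)
    then have "M \<le> ennreal t"
      unfolding M_def by (rule esssup_I[OF meas])
    with that show False by simp
  qed
  have lower: "emeasure h {x. 0 < \<phi> x \<and> \<phi> x < s} \<noteq> 0" if "m < ennreal s" for s
  proof
    assume "emeasure h {x. 0 < \<phi> x \<and> \<phi> x < s} = 0"
    then have "AE x in h. \<not> (0 < \<phi> x \<and> \<phi> x < s)"
      by (subst AE_iff_measurable[OF _ refl]) (simp_all add: sp)
    then have "AE x in \<mu>. ennreal s \<le> ennreal (\<phi> x)"
      unfolding AE_\<mu> by eventually_elim (auto intro: ennreal_leI)
    then have "ennreal s \<le> m"
      unfolding m_def essinf_def by (intro Sup_upper) simp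
    with that show False by simp
  qed
  \<comment> \<open>For \<mu> = 0 every bound holds almost everywhere, so the essential bounds take
    the extreme values of \<open>ennreal\<close>. The quotient M / m is then 0.\<close>
  have null: "M = 0 \<and> m = \<infinity>" if "AE x in h. \<phi> x = 0"
  proof
    have all: "AE x in \<mu>. P x" for P
      using that unfolding AE_\<mu> by eventually_elim simp
    show "M = 0"
      using esssup_I[OF meas all, of 0] by (simp add: M_def)
    have "ennreal (real n) \<le> m" for n
      unfolding m_def essinf_def by (intro Sup_upper) (simp add: all)
    then show "m = \<infinity>"
      by (metis ennreal_of_nat_eq_real_of_nat ennreal_Ex_less_of_nat infinity_ennreal_def
          not_le top.not_eq_extremum)
  qed
  have nonnull: "0 < M \<and> m < \<infinity>" if "\<not> (AE x in h. \<phi> x = 0)"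
  proof
    show "0 < M"
    proof (rule ccontr)
      assume "\<not> 0 < M"
      then have "AE x in \<mu>. ennreal (\<phi> x) \<le> 0"
        using esssup_AE[where M = \<mu> and f = "\<lambda>x. ennreal (\<phi> x)"] by (simp add: M_def)
      then have "AE x in h. \<phi> x = 0"
        unfolding AE_\<mu>
      proof eventually_elim
        case (elim x)
        then show ?case using \<phi>(2)[of x] by (cases "\<phi> x = 0") (auto simp: ennreal_eq_0_iff)
      qed
      with that show False ..
    qed
    show "m < \<infinity>"
    proof (rule ccontr)
      assume "\<not> m < \<infinity>"
      then have top: "m = \<infinity>" by (simp add: less_top[symmetric])
      have "AE x in \<mu>. ennreal (real n) \<le> ennreal (\<phi> x)" for n
      proof -
        have "ennreal (real n) < m" by (simp add: top)
        then obtain k where "ennreal (real n) < k" "AE x in \<mu>. k \<le> ennreal (\<phi> x)"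
          unfolding m_def essinf_def less_Sup_iff by blast
        then show ?thesis by (auto elim: eventually_mono)
      qed
      then have "AE x in \<mu>. \<forall>n. ennreal (real n) \<le> ennreal (\<phi> x)"
        by (simp add: AE_all_countable)
      then have "AE x in h. \<phi> x = 0"
        unfolding AE_\<mu>
      proof eventually_elim
        case (elim x)
        obtain n where "\<phi> x < real n" using reals_Archimedean2 by blast
        then show ?case
          using elim \<phi>(2)[of x] by (auto simp: not_le intro: ccontr dest!: spec[of _ n])
      qed
      with that show False ..
    qed
  qed
  \<comment> \<open>The first two conjuncts give the nonexistence claim by contraposition.\<close>
  have bound: "M \<noteq> \<infinity> \<and> m \<noteq> 0 \<and> ennreal_powr (M / m) e \<le> ennreal (B / A)"
    if frame: "frame_measure p q \<mu> \<nu> A B" for \<nu> A B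
  proof (cases "AE x in h. \<phi> x = 0")
    case True
    then show ?thesis
      using null[OF True] by (simp add: ennreal_powr_def)
  next
    case False
    note M0 = conjunct1[OF nonnull[OF False]] and m_fin = conjunct2[OF nonnull[OF False]]
    have AB: "0 < A" "A \<le> B" using frame by (auto simp: frame_measure_def)
    \<comment> \<open>Taking the e-th root makes the level estimate linear, t \<le> C * s, so limits
      in \<open>ennreal\<close> involve no powers.\<close>
    define C where "C = (B / A) powr (1 / e)"
    have C: "0 < C" "C powr e = B / A" using AB e by (simp_all add: C_def powr_powr)
    have ts: "t \<le> C * s" if t: "ennreal t < M" "0 < t" and s: "m < ennreal s" for s t
    proof -
      have s0: "0 < s" using s by (metis ennreal_neg not_le not_less_zero)
      have "(t / s) powr e \<le> C powr e"
        unfolding C(2) unfolding e_def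
        using frame_measure_level_ratio[OF h sf sc p q \<phi> \<mu> assms(9) frame s0 lower[OF s] t(2) upper[OF t(1)]]
          t(2) by simp
      then have "t / s \<le> C"
        using C(1) e powr_less_mono2[of e C "t / s"] by (force simp: not_le[symmetric])
      then show ?thesis using s0 by (simp add: field_simps)
    qed
    \<comment> \<open>Here t rises to \<open>M\<close> with y fixed; \<open>Mm\<close> then lets y
      fall to \<open>m\<close>, dividing by \<open>C\<close> first so that \<open>dense_ge\<close>
      applies.\<close>
    have Ms: "M \<le> ennreal C * y" if "m < y" for y
    proof (cases "y = \<infinity>")
      case True
      then show ?thesis using C(1) by (simp add: ennreal_mult_top)
    next
      case False
      then obtain s where s: "y = ennreal s" "0 \<le> s" by (cases y) auto
      show ?thesis
      proof (rule dense_le)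
        fix z assume z: "z < M"
        then obtain t where t: "z = ennreal t" "0 \<le> t" by (cases z) auto
        show "z \<le> ennreal C * y"
          using ts[of t s] t s z that C(1)
          by (cases "t = 0") (auto simp: ennreal_mult[symmetric] intro!: ennreal_leI)
      qed
    qed
    have Mm: "M \<le> ennreal C * m"
    proof -
      have "M / ennreal C \<le> m"
      proof (rule dense_ge)
        fix y assume "m < y"
        then show "M / ennreal C \<le> y"
          using Ms C(1) by (auto simp: divide_le_posI_ennreal mult.commute)
      qed
      then have "ennreal C * (M / ennreal C) \<le> ennreal C * m"
        by (rule mult_left_mono) simp
      moreover have "ennreal C * (M / ennreal C) = M"
        using C(1) mult_divide_eq_ennreal[of "ennreal C" M]
        by (simp add: ennreal_times_divide mult.commute)
      ultimately show ?thesis by simp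
    qed
    \<comment> \<open>Through \<open>Mm\<close>, finiteness passes from \<open>m\<close> to
      \<open>M\<close> and positivity from \<open>M\<close> to \<open>m\<close>, so the quotient is
      one of positive reals.\<close>
    obtain m' where m': "m = ennreal m'" "0 \<le> m'" using m_fin by (cases m) auto
    have "M < \<infinity>"
      using Mm m' C by (auto simp: ennreal_mult[symmetric] intro: le_less_trans)
    then obtain M' where M': "M = ennreal M'" "0 \<le> M'" by (cases M) auto
    have le: "M' \<le> C * m'" using Mm m' M' C by (simp add: ennreal_mult[symmetric])
    have "0 < M'" using M0 M' by simp
    then have "0 < m'" using le m' by (cases "m' = 0") auto
    then have "M' / m' \<le> C" using le by (simp add: field_simps)
    then have "(M' / m') powr e \<le> B / A"
      unfolding C(2)[symmetric] using e M' m' by (intro powr_mono2) auto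
    then show ?thesis
      using \<open>0 < m'\<close> \<open>0 < M'\<close> m' M' by (simp add: ennreal_powr_def divide_ennreal ennreal_leI)
  qed
  show ?thesis
    using bound unfolding M_def m_def e_def by blast
qed

end
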